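(* Let \[ b_n=\frac{q^{\nu+n+1}}{1-q^{\nu+n+1}},\qquad a_n =\frac{q^{2\nu+2n+1}}{(1-q^{\nu+n})(1-q^{\nu+n+1})} ,\qquad \lambda_n =0, \] \[ b'_n=a'_n=0, \qquad \lambda'_{2i} = \frac{q^{2\nu+3i+1}}{(1-q^{\nu+2i})(1-q^{\nu+2i+1})}, \qquad \lambda'_{2i+1} = \frac{q^{\nu+i+1}}{(1-q^{\nu+2i+1})(1-q^{\nu+2i+2})}. \] Then \[ \frac{J_{\nu+1}(z;q^{-1})}{J_{\nu}(z;q^{-1})} = \frac{q^{\nu+1}z}{q^{\nu+1}-1} \sum_{n\ge0}\mu_n(b,a,\lambda) z^{2n} = \frac{q^{\nu+1}z}{q^{\nu+1}-1} \sum_{n\ge0}\mu_{2n}(b',a',\lambda') z^{2n}. \]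
   Context: For sequences $b,a,\lambda$, $\mu_n(b,a,\lambda)$ are the coefficients of the formal power series in $t$ given by $\sum_{n\ge0}\mu_n t^n=\cfrac{1}{1-b_0t-\cfrac{a_1t+\lambda_1t^2}{1-b_1t-\cfrac{a_2t+\lambda_2t^2}{1-b_2t-\cdots}}}$. With $(x;p)_n=\prod_{i=0}^{n-1}(1-xp^i)$, the Hahn–Exton ratio with base $p=q^{-1}$ is the formal power series $\frac{J_{\nu+1}(w;p)}{J_\nu(w;p)}=\frac{w}{1-p^{\nu+1}}\frac{\Phi_{\nu+1}(w;p)}{\Phi_\nu(w;p)}$, $\Phi_\nu(w;p)=\sum_{n\ge0}\frac{(-1)^np^{\binom n2}(pw^2)^n}{(p;p)_n(p^{\nu+1};p)_n}$ (coming from $J_\nu(w;p)=\frac{(p^{\nu+1};p)_\infty w^\nu}{(p;p)_\infty}\Phi_\nu(w;p)$). *)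

theory Defs
  imports Complex_Main "HOL-Computational_Algebra.Formal_Power_Series"
begin

section \<open>Powers with non-integral exponents\<close>

text \<open>
  \<^term>\<open>qpow s\<close> stands for the power \<open>q\<^sup>s\<close>. The exponents \<open>s\<close> range over a ring
  containing the parameter \<open>\<nu>\<close> and the integers. This covers a complex \<open>q \<noteq> 0\<close> with
  complex exponents and any branch of the logarithm of \<open>q\<close>, as well as \<open>q\<close> and \<open>q\<^sup>\<nu>\<close>
  being independent indeterminates.
\<close>

definition is_power_map :: "'a::field \<Rightarrow> ('e::ring_1 \<Rightarrow> 'a) \<Rightarrow> bool" where
  "is_power_map q qpow \<longleftrightarrow>
     q \<noteq> 0 \<and> qpow 0 = 1 \<and> qpow 1 = q \<and> (\<forall>s t. qpow (s + t) = qpow s * qpow t)"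

lemma is_power_map_exp:
  fixes h :: complex
  shows "is_power_map (exp h) (\<lambda>s::complex. exp (s * h))"
  by (simp add: is_power_map_def distrib_right exp_add)

lemma is_power_map_inverse:
  assumes "is_power_map q qpow"
  shows "is_power_map (inverse q) (\<lambda>s. qpow (- s))"
proof -
  have "qpow (- 1) * q = 1"
    using assms unfolding is_power_map_def by (metis add.left_inverse)
  then have "qpow (- 1) = inverse q"
    using inverse_unique[of q "qpow (- 1)"] by (simp add: mult.commute)
  then show ?thesis
    using assms unfolding is_power_map_def
    by (metis inverse_nonzero_iff_nonzero minus_add_distrib minus_zero)
qed


section \<open>Coefficients of the continued fraction\<close>

text \<open>
  \<^term>\<open>convergent_from b a lam N k\<close> is the tail of the continued fraction that starts
  at the denominator \<open>1 - b\<^sub>k t - \<dots>\<close>, cut off after \<open>N\<close> levels.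
\<close>

fun convergent_from ::
  "(nat \<Rightarrow> 'a::field) \<Rightarrow> (nat \<Rightarrow> 'a) \<Rightarrow> (nat \<Rightarrow> 'a) \<Rightarrow> nat \<Rightarrow> nat \<Rightarrow> 'a fps" where
  "convergent_from b a lam 0 k = 0"
| "convergent_from b a lam (Suc N) k =
     1 / (1 - fps_const (b k) * fps_X
            - (fps_const (a (Suc k)) * fps_X + fps_const (lam (Suc k)) * fps_X ^ 2)
              * convergent_from b a lam N (Suc k))"

definition cont_frac ::
  "(nat \<Rightarrow> 'a::field) \<Rightarrow> (nat \<Rightarrow> 'a) \<Rightarrow> (nat \<Rightarrow> 'a) \<Rightarrow> 'a fps" where
  "cont_frac b a lam = lim (\<lambda>N. convergent_from b a lam N 0)"

definition mu :: "(nat \<Rightarrow> 'a::field) \<Rightarrow> (nat \<Rightarrow> 'a) \<Rightarrow> (nat \<Rightarrow> 'a) \<Rightarrow> nat \<Rightarrow> 'a" where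
  "mu b a lam n = fps_nth (cont_frac b a lam) n"

lemma convergent_from_step:
  "fps_X ^ N dvd convergent_from b a lam (Suc N) k - convergent_from b a lam N k"
proof (induction N arbitrary: k)
  case 0
  show ?case by simp
next
  case (Suc N)
  define h where "h = fps_const (a (Suc k)) + fps_const (lam (Suc k)) * fps_X"
  define F where "F = convergent_from b a lam (Suc N) (Suc k)"
  define G where "G = convergent_from b a lam N (Suc k)"
  define D where "D f = 1 - fps_const (b k) * fps_X - fps_X * h * f" for f
  have h: "fps_const (a (Suc k)) * fps_X + fps_const (lam (Suc k)) * fps_X ^ 2 = fps_X * h"
    by (simp add: h_def algebra_simps power2_eq_square)
  have nz: "fps_nth (D f) 0 \<noteq> 0" for f
    by (simp add: D_def mult.assoc)
  have inv: "D f * inverse (D f) = 1" for f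
    using inverse_mult_eq_1'[OF nz] .
  have quot: "1 / D f = inverse (D f)" for f
    using nz by (simp add: fps_divide_unit)
  have "convergent_from b a lam (Suc (Suc N)) k - convergent_from b a lam (Suc N) k
      = inverse (D F) - inverse (D G)"
    by (simp only: convergent_from.simps(2)[of b a lam "Suc N" k]
        convergent_from.simps(2)[of b a lam N k] F_def G_def h quot D_def[symmetric])
  also have "\<dots> = inverse (D F) * inverse (D G) * (D G - D F)"
    using inv[of F] inv[of G] by (simp add: algebra_simps)
  also have "D G - D F = fps_X * (F - G) * h"
    by (simp add: D_def algebra_simps)
  finally show ?case
    using mult_dvd_mono[OF dvd_refl[of fps_X] Suc.IH[of "Suc k"]]
    by (simp add: F_def G_def)
qed

lemma convergent_from_stable:
  assumes "n < M" "M \<le> N"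
  shows "fps_nth (convergent_from b a lam N k) n = fps_nth (convergent_from b a lam M k) n"
  using assms(2)
proof (induction N rule: dec_induct)
  case base
  show ?case ..
next
  case (step N)
  have "fps_nth (convergent_from b a lam (Suc N) k - convergent_from b a lam N k) n = 0"
  proof -
    obtain g where "convergent_from b a lam (Suc N) k - convergent_from b a lam N k
        = fps_X ^ N * g"
      using convergent_from_step by (rule dvdE)
    then show ?thesis
      using assms(1) step.hyps by (simp only: fps_X_power_mult_nth) simp
  qed
  then show ?case using step.IH by simp
qed

lemma convergent_from_tendsto:
  "(\<lambda>N. convergent_from b a lam N 0) \<longlonglongrightarrow> cont_frac b a lam"
proof -
  have "(\<lambda>N. convergent_from b a lam N 0)
      \<longlonglongrightarrow> Abs_fps (\<lambda>n. fps_nth (convergent_from b a lam (Suc n) 0) n)"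
  proof (rule tendsto_fpsI)
    fix n
    show "\<forall>\<^sub>F N in sequentially. fps_nth (convergent_from b a lam N 0) n
        = fps_nth (Abs_fps (\<lambda>n. fps_nth (convergent_from b a lam (Suc n) 0) n)) n"
      using eventually_ge_at_top[of "Suc n"]
      by eventually_elim (simp only: fps_nth_Abs_fps, rule convergent_from_stable, auto)
  qed
  then show ?thesis
    unfolding cont_frac_def by (simp add: limI)
qed

lemma mu_eq_convergent:
  assumes "n < N"
  shows "mu b a lam n = fps_nth (convergent_from b a lam N 0) n"
proof -
  from convergent_from_tendsto[of b a lam]
  have "\<forall>\<^sub>F M in sequentially.
      fps_nth (convergent_from b a lam M 0) n = fps_nth (cont_frac b a lam) n"
    by (simp add: tendsto_fps_iff)
  then obtain M0 where
    "\<And>M. M \<ge> M0 \<Longrightarrow> fps_nth (convergent_from b a lam M 0) n = fps_nth (cont_frac b a lam) n"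
    by (auto simp: eventually_sequentially)
  from this[of "max M0 N"] show ?thesis
    using convergent_from_stable[OF assms, of "max M0 N" b a lam 0] by (simp add: mu_def)
qed


section \<open>The Hahn--Exton ratio\<close>

definition qpoch :: "'a::field \<Rightarrow> 'a \<Rightarrow> nat \<Rightarrow> 'a" where
  "qpoch x p n = (\<Prod>i<n. 1 - x * p ^ i)"

text \<open>Below, \<^term>\<open>ppow s\<close> is the power \<open>p\<^sup>s\<close>, and \<^term>\<open>fps_X\<close> is the variable \<open>w\<close>.\<close>

definition hahn_exton_Phi :: "'a::field \<Rightarrow> ('e::ring_1 \<Rightarrow> 'a) \<Rightarrow> 'e \<Rightarrow> 'a fps" where
  "hahn_exton_Phi p ppow \<nu> =
     Abs_fps (\<lambda>n. (-1) ^ n * p ^ (n choose 2) / (qpoch p p n * qpoch (ppow (\<nu> + 1)) p n))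
       oo (fps_const p * fps_X ^ 2)"

text \<open>
  This is the series for \<open>J\<^sub>\<nu>\<^sub>+\<^sub>1(w;p) / J\<^sub>\<nu>(w;p)\<close>. The factors \<open>w\<^sup>\<nu>\<close> and the infinite
  products, which need not converge, have been cancelled formally.
\<close>

definition hahn_exton_ratio :: "'a::field \<Rightarrow> ('e::ring_1 \<Rightarrow> 'a) \<Rightarrow> 'e \<Rightarrow> 'a fps" where
  "hahn_exton_ratio p ppow \<nu> =
     fps_const (1 / (1 - ppow (\<nu> + 1))) * fps_X
       * (hahn_exton_Phi p ppow (\<nu> + 1) / hahn_exton_Phi p ppow \<nu>)"

end

theory Submission
  imports Defs
begin

text \<open>
  Put \<open>x = q\<^sup>\<nu>\<close>, \<open>t = w\<^sup>2\<close> and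
  \<open>E(z, y) = \<Sum>\<^sub>n (-z t)\<^sup>n q\<^sup>n\<^sup>(\<^sup>n\<^sup>+\<^sup>1\<^sup>)\<^sup>/\<^sup>2 / ((q;q)\<^sub>n (yq;q)\<^sub>n)\<close>. Reversing the base
  turns \<open>\<Phi>\<^sub>\<nu>(w;q\<^sup>-\<^sup>1)\<close> into \<open>E(x, x)\<close>, so the ratio in question is \<open>E(xq, xq) / E(x, x)\<close> up
  to its prefactor. A sequence \<open>G\<close> of power series with constant term \<open>1\<close> and
  \<open>G\<^sub>k = (1 - b\<^sub>k t) G\<^sub>k\<^sub>+\<^sub>1 - (a\<^sub>k\<^sub>+\<^sub>1 t + \<lambda>\<^sub>k\<^sub>+\<^sub>1 t\<^sup>2) G\<^sub>k\<^sub>+\<^sub>2\<close> exhibits \<open>G\<^sub>1 / G\<^sub>0\<close> as the continued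
  fraction. Contiguous relations for \<open>E\<close> show that \<open>G\<^sub>k = E(xq\<^sup>k, xq\<^sup>k)\<close> works for the first
  fraction, and \<open>G\<^sub>2\<^sub>i = E(xq\<^sup>i, xq\<^sup>2\<^sup>i)\<close>, \<open>G\<^sub>2\<^sub>i\<^sub>+\<^sub>1 = E(xq\<^sup>i\<^sup>+\<^sup>1, xq\<^sup>2\<^sup>i\<^sup>+\<^sup>1)\<close>, with \<open>t\<^sup>2\<close>
  substituted for \<open>t\<close>, for the second.
\<close>

section \<open>Uniqueness of the continued fraction expansion\<close>

text \<open>A difference of two reciprocals carries the difference of the denominators as a factor.
  Here that difference is a multiple of t times the error of the next tail, so every level gains one
  factor of t.\<close>

lemma convergent_from_approx:
  assumes R: "\<And>k. R k * (1 - fps_const (b k) * fps_X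
      - (fps_const (a (Suc k)) * fps_X + fps_const (lam (Suc k)) * fps_X ^ 2) * R (Suc k)) = 1"
  shows "fps_X ^ N dvd R k - convergent_from b a lam N k"
proof (induction N arbitrary: k)
  case 0
  show ?case by simp
next
  case (Suc N)
  define h where "h = fps_const (a (Suc k)) + fps_const (lam (Suc k)) * fps_X"
  define D where "D f = 1 - fps_const (b k) * fps_X - fps_X * h * f" for f
  define C where "C = convergent_from b a lam N (Suc k)"
  have h: "fps_const (a (Suc k)) * fps_X + fps_const (lam (Suc k)) * fps_X ^ 2 = fps_X * h"
    by (simp add: h_def algebra_simps power2_eq_square)
  have nz: "fps_nth (D C) 0 \<noteq> 0"
    by (simp add: D_def mult.assoc)
  have conv: "convergent_from b a lam (Suc N) k = inverse (D C)"
    using nz by (simp add: h C_def D_def fps_divide_unit)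
  have inv: "D C * inverse (D C) = 1"
    using inverse_mult_eq_1'[OF nz] .
  have RD: "R k * D (R (Suc k)) = 1"
    using R[of k] unfolding h D_def .
  have "R k - inverse (D C) = R k * (D C * inverse (D C)) - R k * D (R (Suc k)) * inverse (D C)"
    unfolding inv RD by simp
  also have "\<dots> = R k * inverse (D C) * (D C - D (R (Suc k)))"
    by (simp add: algebra_simps)
  also have "D C - D (R (Suc k)) = fps_X * (R (Suc k) - C) * h"
    by (simp add: D_def algebra_simps)
  finally show ?case
    using mult_dvd_mono[OF dvd_refl[of fps_X] Suc.IH[of "Suc k"]]
    unfolding conv C_def by simp
qed

text \<open>Agreement with the convergent of \<open>Suc n\<close> levels modulo t^(n+1) settles
  coefficient n.\<close>

lemma cont_frac_unique:
  assumes "\<And>k. R k * (1 - fps_const (b k) * fps_X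
      - (fps_const (a (Suc k)) * fps_X + fps_const (lam (Suc k)) * fps_X ^ 2) * R (Suc k)) = 1"
  shows "cont_frac b a lam = R 0"
proof (rule fps_ext)
  fix n
  obtain h where "R 0 - convergent_from b a lam (Suc n) 0 = fps_X ^ Suc n * h"
    using convergent_from_approx[of R b a lam, OF assms] by (rule dvdE)
  then have "fps_nth (R 0 - convergent_from b a lam (Suc n) 0) n = 0"
    by (simp only: fps_X_power_mult_nth) simp
  then show "fps_nth (cont_frac b a lam) n = fps_nth (R 0) n"
    using mu_eq_convergent[of n "Suc n" b a lam] by (simp add: mu_def)
qed

text \<open>Dividing the recurrence by \<open>G k\<close> shows that the ratios
  \<open>G (Suc k) / G k\<close> satisfy the tail equation of \<open>cont_frac_unique\<close>.
  Nonzero constant terms make every \<open>G k\<close> invertible.\<close>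

lemma cont_frac_eq_ratio:
  assumes G0: "\<And>k. fps_nth (G k) 0 \<noteq> 0"
    and G: "\<And>k. G k = (1 - fps_const (b k) * fps_X) * G (Suc k)
      - (fps_const (a (Suc k)) * fps_X + fps_const (lam (Suc k)) * fps_X ^ 2) * G (Suc (Suc k))"
  shows "cont_frac b a lam = G 1 / G 0"
proof -
  define R where "R k = G (Suc k) * inverse (G k)" for k
  have inv: "inverse (G k) * G k = 1" for k
    by (rule inverse_mult_eq_1[OF G0])
  have "R k * (1 - fps_const (b k) * fps_X
      - (fps_const (a (Suc k)) * fps_X + fps_const (lam (Suc k)) * fps_X ^ 2) * R (Suc k)) = 1"
    (is "_ * (1 - ?b - ?c * _) = 1") for k
  proof -
    \<comment> \<open>The product \<open>R k * R (Suc k)\<close> produces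
      \<open>inverse (G (Suc k)) * G (Suc k)\<close>, kept visible here so that \<open>inv\<close>
      cancels it next.\<close>
    have "R k * (1 - ?b - ?c * R (Suc k)) = inverse (G k)
        * ((1 - ?b) * G (Suc k) - ?c * G (Suc (Suc k)) * (inverse (G (Suc k)) * G (Suc k)))"
      by (simp add: R_def algebra_simps)
    also have "\<dots> = inverse (G k) * G k"
      by (simp only: inv mult_1_right G[of k, symmetric])
    finally show ?thesis unfolding inv .
  qed
  then have "cont_frac b a lam = R 0" by (rule cont_frac_unique)
  then show ?thesis using G0[of 0] by (simp add: R_def fps_divide_unit)
qed

section \<open>q-Pochhammer symbols\<close>

lemma qpoch_0: "qpoch x p 0 = 1"
  by (simp add: qpoch_def)

lemma qpoch_Suc: "qpoch x p (Suc n) = qpoch x p n * (1 - x * p ^ n)"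
  by (simp add: qpoch_def)

lemma qpoch_Suc_shift: "qpoch x p (Suc n) = (1 - x) * qpoch (x * p) p n"
  unfolding qpoch_def prod.lessThan_Suc_shift by (simp add: mult.assoc)

text \<open>Factor by factor, (1 - 1/(x q^i)) x q^i = -(1 - x q^i), and the product of x q^i over i
  < n is x^n q^(n choose 2).\<close>

lemma qpoch_inverse_base:
  fixes q x :: "'a::field"
  assumes "q \<noteq> 0" "x \<noteq> 0"
  shows "qpoch (inverse x) (inverse q) n * x ^ n * q ^ (n choose 2) = (- 1) ^ n * qpoch x q n"
proof (induction n)
  case 0
  show ?case by (simp add: qpoch_0 numeral_2_eq_2)
next
  case (Suc n)
  have "Suc n choose 2 = n + (n choose 2)"
    by (simp add: numeral_2_eq_2)
  then have "qpoch (inverse x) (inverse q) (Suc n) * x ^ Suc n * q ^ (Suc n choose 2)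
      = (qpoch (inverse x) (inverse q) n * x ^ n * q ^ (n choose 2))
        * ((1 - inverse x * inverse q ^ n) * x * q ^ n)"
    by (simp add: qpoch_Suc power_add algebra_simps)
  also have "(1 - inverse x * inverse q ^ n) * x * q ^ n = - (1 - x * q ^ n)"
    using assms by (simp add: field_simps)
  also have "qpoch (inverse x) (inverse q) n * x ^ n * q ^ (n choose 2) * - (1 - x * q ^ n)
      = (- 1) ^ Suc n * qpoch x q (Suc n)"
    unfolding Suc.IH qpoch_Suc by (simp add: algebra_simps)
  finally show ?case .
qed

section \<open>The series E(z, y) and its shifts\<close>

text \<open>This is E(z, y), the basic hypergeometric series 1phi1(0; yq; q, zqt). Scale z and
  parameter y are kept apart because the second fraction advances them at different rates.\<close>

definition hahn_series :: "'a::field \<Rightarrow> 'a \<Rightarrow> 'a \<Rightarrow> 'a fps" where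
  "hahn_series q z y =
     Abs_fps (\<lambda>n. (- z) ^ n * q ^ (Suc n choose 2) / (qpoch q q n * qpoch (y * q) q n))"

lemma hahn_series_nth:
  "fps_nth (hahn_series q z y) n
     = (- z) ^ n * q ^ (Suc n choose 2) / (qpoch q q n * qpoch (y * q) q n)"
  by (simp add: hahn_series_def)

lemma hahn_series_nth_0 [simp]: "fps_nth (hahn_series q z y) 0 = 1"
  by (simp add: hahn_series_nth qpoch_0 numeral_2_eq_2)

lemma hahn_series_dilate:
  "fps_nth (hahn_series q (z * q) y) n = q ^ n * fps_nth (hahn_series q z y) n"
  using power_mult_distrib[of "- z" q n] by (simp add: hahn_series_nth)

text \<open>The product (yq;q)_(n+1) can be split at its first or at its last factor.\<close>

lemma hahn_series_shift_parameter:
  assumes "\<And>n. n \<ge> 1 \<Longrightarrow> y * q ^ n \<noteq> 1"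
  shows "(1 - y * q) * fps_nth (hahn_series q z y) n
    = (1 - y * q ^ Suc n) * fps_nth (hahn_series q z (y * q)) n"
proof -
  have nz: "1 - y * q \<noteq> 0" "1 - y * q ^ Suc n \<noteq> 0"
    using assms[of 1] assms[of "Suc n"] by auto
  have "qpoch (y * q) q n * (1 - y * q ^ Suc n) = (1 - y * q) * qpoch (y * q * q) q n"
    using qpoch_Suc[of "y * q" q n] qpoch_Suc_shift[of "y * q" q n] by (simp add: mult.assoc)
  then have "qpoch (y * q * q) q n = qpoch (y * q) q n * (1 - y * q ^ Suc n) / (1 - y * q)"
    using nz by (simp add: field_simps)
  then show ?thesis
    using nz by (simp add: hahn_series_nth del: power_Suc)
qed

text \<open>Multiplication by t shifts the index, and consecutive coefficients of E(z, y) have ratio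
  -z q^n / ((1 - q^n)(1 - y q^n)). The dilation supplies q^(n-1) of the power q^n. For n = 0 both
  sides vanish.\<close>

lemma hahn_series_times_X:
  assumes q: "\<And>n. n \<ge> 1 \<Longrightarrow> q ^ n \<noteq> 1" and y: "\<And>n. n \<ge> 1 \<Longrightarrow> y * q ^ n \<noteq> 1"
  shows "z * q * fps_nth (fps_X * hahn_series q (z * q) y) n
    = - ((1 - q ^ n) * (1 - y * q ^ n) * fps_nth (hahn_series q z y) n)"
proof (cases n)
  case 0
  then show ?thesis by simp
next
  case (Suc m)
  have nz: "1 - q ^ n \<noteq> 0" "1 - y * q ^ n \<noteq> 0"
    using q[of n] y[of n] Suc by auto
  have "qpoch q q n = qpoch q q m * (1 - q ^ n)"
    "qpoch (y * q) q n = qpoch (y * q) q m * (1 - y * q ^ n)"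
    using Suc by (simp_all add: qpoch_Suc mult.assoc)
  moreover have "Suc n choose 2 = Suc m + (Suc m choose 2)"
    using Suc by (simp add: numeral_2_eq_2)
  moreover have "(- z) ^ n = - z * (- z) ^ m" using Suc by simp
  moreover have "fps_nth (fps_X * hahn_series q (z * q) y) n
      = q ^ m * fps_nth (hahn_series q z y) m"
    using Suc by (simp add: hahn_series_dilate)
  ultimately show ?thesis
    using nz by (simp add: hahn_series_nth power_add)
qed

section \<open>Contiguous relations\<close>

context
  fixes q y :: "'a::field"
  assumes q: "\<And>n. n \<ge> 1 \<Longrightarrow> q ^ n \<noteq> 1"
    and y: "\<And>n. n \<ge> 1 \<Longrightarrow> y * q ^ n \<noteq> 1"
begin

text \<open>Expressing all coefficients through one quantity e reduces each two-step contiguous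
  relation to a polynomial identity in q^n.\<close>

lemma hahn_series_coeff_contiguous:
  obtains e where
    "fps_nth (hahn_series q z (y * q)) n = (1 - y * q ^ 2 * q ^ n) * e / (1 - y * q ^ 2)"
    "fps_nth (hahn_series q z y) n
       = (1 - y * q * q ^ n) * (1 - y * q ^ 2 * q ^ n) * e / ((1 - y * q) * (1 - y * q ^ 2))"
    "z * q * fps_nth (fps_X * hahn_series q (z * q) (y * q ^ 2)) n
       = - ((1 - q ^ n) * (1 - y * q ^ 2 * q ^ n) * e)"
proof
  have nz: "1 - y * q \<noteq> 0" "1 - y * q ^ 2 \<noteq> 0"
    using y[of 1] y[of 2] by auto
  have y1: "y * q * q ^ n \<noteq> 1" and y2: "y * q ^ 2 * q ^ n \<noteq> 1" if "n \<ge> 1" for n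
    using y[of "1 + n"] y[of "2 + n"] by (simp_all add: power_add mult.assoc power2_eq_square)
  \<comment> \<open>The most shifted parameter serves as reference, since lowering it only
    multiplies by explicit factors.\<close>
  let ?e = "fps_nth (hahn_series q z (y * q ^ 2)) n"
  have "(1 - y * q ^ 2) * fps_nth (hahn_series q z (y * q)) n = (1 - y * q ^ 2 * q ^ n) * ?e"
    using hahn_series_shift_parameter[of "y * q" q z n, OF y1]
    by (simp add: power2_eq_square mult.assoc)
  then show 1: "fps_nth (hahn_series q z (y * q)) n = (1 - y * q ^ 2 * q ^ n) * ?e / (1 - y * q ^ 2)"
    using nz by (metis nonzero_mult_div_cancel_left)
  have "(1 - y * q) * fps_nth (hahn_series q z y) n
      = (1 - y * q * q ^ n) * fps_nth (hahn_series q z (y * q)) n"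
    using hahn_series_shift_parameter[of y q z n, OF y] by (simp add: mult.assoc)
  then show "fps_nth (hahn_series q z y) n
      = (1 - y * q * q ^ n) * (1 - y * q ^ 2 * q ^ n) * ?e / ((1 - y * q) * (1 - y * q ^ 2))"
    using nz unfolding 1 by (simp add: eq_divide_eq mult_ac)
  show "z * q * fps_nth (fps_X * hahn_series q (z * q) (y * q ^ 2)) n
      = - ((1 - q ^ n) * (1 - y * q ^ 2 * q ^ n) * ?e)"
    by (rule hahn_series_times_X) (use q y2 in auto)
qed

text \<open>With u = q^n, after removal of common factors this is 1 - yqu = u(1 - yq) + (1 - u); the
  factor u is the dilation.\<close>

lemma hahn_series_contiguous_dilated:
  "hahn_series q z y = hahn_series q (z * q) (y * q)
     - fps_const (z * q / ((1 - y * q) * (1 - y * q ^ 2))) * fps_X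
       * hahn_series q (z * q) (y * q ^ 2)" (is "_ = _ - fps_const (_ / ?D) * _ * ?H")
proof (rule fps_ext)
  fix n
  have nz: "1 - y * q \<noteq> 0" "1 - y * q ^ 2 \<noteq> 0"
    using y[of 1] y[of 2] by auto
  obtain e where e: "fps_nth (hahn_series q z (y * q)) n = (1 - y * q ^ 2 * q ^ n) * e / (1 - y * q ^ 2)"
    "fps_nth (hahn_series q z y) n
       = (1 - y * q * q ^ n) * (1 - y * q ^ 2 * q ^ n) * e / ((1 - y * q) * (1 - y * q ^ 2))"
    "z * q * fps_nth (fps_X * ?H) n = - ((1 - q ^ n) * (1 - y * q ^ 2 * q ^ n) * e)"
    by (rule hahn_series_coeff_contiguous)
  have X: "fps_nth (fps_const (z * q / ?D) * fps_X * ?H) n = z * q * fps_nth (fps_X * ?H) n / ?D"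
    by (simp add: mult.assoc)
  show "fps_nth (hahn_series q z y) n = fps_nth (hahn_series q (z * q) (y * q)
     - fps_const (z * q / ?D) * fps_X * ?H) n"
    unfolding fps_sub_nth X hahn_series_dilate e
    using nz by (simp add: divide_simps) (simp add: algebra_simps)
qed

text \<open>The same coefficient is split as 1 - yqu = (1 - yq) + yq(1 - u), with u = q^n, so the
  first series on the right is not dilated.\<close>

lemma hahn_series_contiguous:
  "hahn_series q z y = hahn_series q z (y * q)
     - fps_const (z * y * q ^ 2 / ((1 - y * q) * (1 - y * q ^ 2))) * fps_X
       * hahn_series q (z * q) (y * q ^ 2)" (is "_ = _ - fps_const (_ / ?D) * _ * ?H")
proof (rule fps_ext)
  fix n
  have nz: "1 - y * q \<noteq> 0" "1 - y * q ^ 2 \<noteq> 0"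
    using y[of 1] y[of 2] by auto
  obtain e where e: "fps_nth (hahn_series q z (y * q)) n = (1 - y * q ^ 2 * q ^ n) * e / (1 - y * q ^ 2)"
    "fps_nth (hahn_series q z y) n
       = (1 - y * q * q ^ n) * (1 - y * q ^ 2 * q ^ n) * e / ((1 - y * q) * (1 - y * q ^ 2))"
    "z * q * fps_nth (fps_X * ?H) n = - ((1 - q ^ n) * (1 - y * q ^ 2 * q ^ n) * e)"
    by (rule hahn_series_coeff_contiguous)
  have X: "fps_nth (fps_const (z * y * q ^ 2 / ?D) * fps_X * ?H) n
      = y * q * (z * q * fps_nth (fps_X * ?H) n) / ?D"
    by (simp add: mult_ac power2_eq_square)
  show "fps_nth (hahn_series q z y) n = fps_nth (hahn_series q z (y * q)
     - fps_const (z * y * q ^ 2 / ?D) * fps_X * ?H) n"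
    unfolding fps_sub_nth X e
    using nz by (simp add: divide_simps) (simp add: algebra_simps power2_eq_square)
qed

text \<open>In \<open>hahn_series_shift_parameter\<close> the term y q^(n+1) is moved across, its
  factor q^n being absorbed by a dilation.\<close>

lemma hahn_series_raise_parameter:
  "hahn_series q z (y * q) = fps_const (1 - y * q) * hahn_series q z y
     + fps_const (y * q) * hahn_series q (z * q) (y * q)"
proof (rule fps_ext)
  fix n
  have *: "(1 - y * q) * fps_nth (hahn_series q z y) n
      = (1 - y * q ^ Suc n) * fps_nth (hahn_series q z (y * q)) n"
    by (rule hahn_series_shift_parameter) (use y in auto)
  show "fps_nth (hahn_series q z (y * q)) n = fps_nth (fps_const (1 - y * q) * hahn_series q z y
     + fps_const (y * q) * hahn_series q (z * q) (y * q)) n"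
    unfolding fps_add_nth fps_mult_left_const_nth * hahn_series_dilate by (simp add: algebra_simps)
qed

end

text \<open>E(zq, yq^2) is eliminated from \<open>hahn_series_contiguous_dilated\<close> by raising
  the parameter of E(zq, yq), so that z and y advance together as the first fraction
  requires.\<close>

lemma hahn_series_three_term:
  assumes q: "\<And>n. n \<ge> 1 \<Longrightarrow> q ^ n \<noteq> 1"
    and y: "\<And>n. n \<ge> 1 \<Longrightarrow> y * q ^ n \<noteq> 1"
  shows "hahn_series q z y
    = (1 - fps_const (z * q / (1 - y * q)) * fps_X) * hahn_series q (z * q) (y * q)
      - fps_const (z * y * q ^ 3 / ((1 - y * q) * (1 - y * q ^ 2))) * fps_X
        * hahn_series q (z * q ^ 2) (y * q ^ 2)"
proof -
  have nz: "1 - y * q \<noteq> 0" "1 - y * q ^ 2 \<noteq> 0"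
    using y[of 1] y[of 2] by auto
  have y1: "y * q * q ^ n \<noteq> 1" if "n \<ge> 1" for n
    using y[of "1 + n"] by (simp add: mult.assoc)
  define A where "A = z * q / ((1 - y * q) * (1 - y * q ^ 2))"
  define F G where "F = hahn_series q (z * q) (y * q)" and "G = hahn_series q (z * q ^ 2) (y * q ^ 2)"
  have "hahn_series q (z * q) (y * q ^ 2)
      = fps_const (1 - y * q ^ 2) * F + fps_const (y * q ^ 2) * G"
    using hahn_series_raise_parameter[of q "y * q" "z * q", OF q y1]
    by (simp add: F_def G_def power2_eq_square mult.assoc)
  then have "hahn_series q z y = F
      - fps_const A * fps_X * (fps_const (1 - y * q ^ 2) * F + fps_const (y * q ^ 2) * G)"
    using hahn_series_contiguous_dilated[of q y z, OF q y] by (simp add: A_def F_def)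
  also have "\<dots> = (1 - fps_const (A * (1 - y * q ^ 2)) * fps_X) * F
      - fps_const (A * (y * q ^ 2)) * fps_X * G"
    unfolding fps_const_mult[symmetric] by (simp only: algebra_simps mult_1_right)
  also have "A * (1 - y * q ^ 2) = z * q / (1 - y * q)"
    using nz by (simp add: A_def)
  also have "A * (y * q ^ 2) = z * y * q ^ 3 / ((1 - y * q) * (1 - y * q ^ 2))"
    by (simp add: A_def numeral_eq_Suc mult_ac)
  finally show ?thesis by (simp only: F_def G_def)
qed

section \<open>Base reversal and even powers\<close>

text \<open>Reversing both Pochhammer symbols cancels the signs and leaves x^n q^(2n) q^(n choose
  2). The factor q^(-n) from the argument p w^2 lowers this to x^n q^(n+1 choose 2).\<close>

lemma hahn_exton_Phi_eq:
  fixes q x :: "'a::field"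
  assumes q0: "q \<noteq> 0" and x0: "x \<noteq> 0"
    and p: "ppow (\<nu> + 1) = inverse (x * q)"
  shows "hahn_exton_Phi (inverse q) ppow \<nu> = hahn_series q x x oo fps_X ^ 2"
proof -
  let ?c = "\<lambda>n. (-1) ^ n * inverse q ^ (n choose 2)
    / (qpoch (inverse q) (inverse q) n * qpoch (ppow (\<nu> + 1)) (inverse q) n)"
  have "hahn_series q x x = Abs_fps ?c oo (fps_const (inverse q) * fps_X)"
  proof (rule fps_ext)
    fix n
    define C where "C = q ^ (n choose 2)"
    have nz: "C \<noteq> 0" "q ^ n \<noteq> 0" "x ^ n \<noteq> 0" using q0 x0 by (simp_all add: C_def)
    have "qpoch (inverse q) (inverse q) n * (q ^ n * C) = (- 1) ^ n * qpoch q q n"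
      using qpoch_inverse_base[OF q0 q0, of n] by (simp add: C_def mult.assoc)
    then have 1: "qpoch (inverse q) (inverse q) n = (- 1) ^ n * qpoch q q n / (q ^ n * C)"
      using nz by (simp add: eq_divide_eq)
    have "qpoch (inverse (x * q)) (inverse q) n * (x ^ n * q ^ n * C) = (- 1) ^ n * qpoch (x * q) q n"
      using qpoch_inverse_base[of q "x * q" n] q0 x0 by (simp add: C_def mult.assoc power_mult_distrib)
    then have 2: "qpoch (ppow (\<nu> + 1)) (inverse q) n = (- 1) ^ n * qpoch (x * q) q n / (x ^ n * q ^ n * C)"
      using nz unfolding p by (simp add: eq_divide_eq)
    have "Suc n choose 2 = n + (n choose 2)" by (simp add: numeral_2_eq_2)
    then have 3: "q ^ (Suc n choose 2) = q ^ n * C" by (simp add: C_def power_add)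
    have 4: "inverse q ^ (n choose 2) = inverse C" "inverse q ^ n = inverse (q ^ n)"
      by (simp_all add: C_def power_inverse)
    have 5: "(- x) ^ n = (- 1) ^ n * x ^ n"
      by (rule power_minus)
    have sgn: "(- 1) ^ n * (- 1) ^ n = (1::'a)"
      by (simp flip: power_mult_distrib)
    show "fps_nth (hahn_series q x x) n = fps_nth (Abs_fps ?c oo (fps_const (inverse q) * fps_X)) n"
      unfolding fps_nth_compose_linear fps_nth_Abs_fps hahn_series_nth 1 2 3 4 5
      using nz sgn by (simp add: divide_simps mult_ac)
  qed
  moreover have "(fps_const (inverse q) * fps_X) oo fps_X ^ 2 = fps_const (inverse q) * fps_X ^ 2"
    by (simp add: fps_compose_mult_distrib)
  ultimately show ?thesis
    by (simp add: hahn_exton_Phi_def fps_compose_assoc[symmetric])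
qed

lemma fps_compose_X_power2_nth_even:
  fixes f :: "'a::comm_ring_1 fps"
  shows "fps_nth (f oo fps_X ^ 2) (2 * n) = fps_nth f n"
proof -
  have "fps_nth (f oo fps_X ^ 2) (2 * n) = (\<Sum>i=0..2 * n. if i = n then fps_nth f i else 0)"
    unfolding fps_compose_nth by (intro sum.cong refl) (auto simp flip: power_mult)
  then show ?thesis by simp
qed

section \<open>Matching the two continued fractions\<close>

theorem theorem6p5:
  fixes q :: "'a::field" and qpow :: "'e::ring_1 \<Rightarrow> 'a" and \<nu> :: 'e
    and b a lam b' a' lam' :: "nat \<Rightarrow> 'a"
  assumes power: "is_power_map q qpow"
    and q_generic: "\<And>n::nat. n \<ge> 1 \<Longrightarrow> q ^ n \<noteq> 1"
    and nu_generic: "\<And>n::nat. n \<ge> 1 \<Longrightarrow> qpow (\<nu> + of_nat n) \<noteq> 1"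
    and b: "\<And>n. b n = qpow (\<nu> + of_nat n + 1) / (1 - qpow (\<nu> + of_nat n + 1))"
    and a: "\<And>n. n \<ge> 1 \<Longrightarrow> a n = qpow (2 * \<nu> + 2 * of_nat n + 1)
              / ((1 - qpow (\<nu> + of_nat n)) * (1 - qpow (\<nu> + of_nat n + 1)))"
    and lam: "\<And>n. n \<ge> 1 \<Longrightarrow> lam n = 0"
    and b': "\<And>n. b' n = 0"
    and a': "\<And>n. n \<ge> 1 \<Longrightarrow> a' n = 0"
    and lam'_even: "\<And>i. i \<ge> 1 \<Longrightarrow> lam' (2 * i) = qpow (2 * \<nu> + 3 * of_nat i + 1)
              / ((1 - qpow (\<nu> + 2 * of_nat i)) * (1 - qpow (\<nu> + 2 * of_nat i + 1)))"
    and lam'_odd: "\<And>i. lam' (2 * i + 1) = qpow (\<nu> + of_nat i + 1)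
              / ((1 - qpow (\<nu> + 2 * of_nat i + 1)) * (1 - qpow (\<nu> + 2 * of_nat i + 2)))"
  shows "hahn_exton_ratio (inverse q) (\<lambda>s. qpow (- s)) \<nu>
           = fps_const (qpow (\<nu> + 1) / (qpow (\<nu> + 1) - 1)) * fps_X
               * (Abs_fps (\<lambda>n. mu b a lam n) oo fps_X ^ 2)
       \<and> hahn_exton_ratio (inverse q) (\<lambda>s. qpow (- s)) \<nu>
           = fps_const (qpow (\<nu> + 1) / (qpow (\<nu> + 1) - 1)) * fps_X
               * (Abs_fps (\<lambda>n. mu b' a' lam' (2 * n)) oo fps_X ^ 2)"
proof -
  define x where "x = qpow \<nu>"
  have q0: "q \<noteq> 0" and qpow0: "qpow 0 = 1" and qpow1: "qpow 1 = q"
    and qpow_add: "\<And>s t. qpow (s + t) = qpow s * qpow t"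
    using power by (simp_all add: is_power_map_def)
  have qpow_nat: "qpow (of_nat n) = q ^ n" for n
    by (induction n) (simp_all add: qpow0 qpow1 qpow_add)
  have qpow_inv: "qpow (- s) = inverse (qpow s)" and qpow_nz: "qpow s \<noteq> 0" for s
  proof -
    have "qpow s * qpow (- s) = 1" by (simp add: qpow0 flip: qpow_add)
    then show "qpow (- s) = inverse (qpow s)" "qpow s \<noteq> 0"
      by (auto simp: inverse_unique)
  qed
  have x0: "x \<noteq> 0" by (simp add: x_def qpow_nz)
  have xq: "x * q ^ n \<noteq> 1" if "n \<ge> 1" for n
    using nu_generic[OF that] by (simp add: x_def qpow_add qpow_nat)
  have xkq: "x * q ^ k * q ^ n \<noteq> 1" if "n \<ge> 1" for k n
    using xq[of "k + n"] that by (simp add: power_add mult.assoc)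
  have double: "qpow (2 * \<nu>) = x ^ 2"
    by (simp add: mult_2 qpow_add x_def power2_eq_square)

  \<comment> \<open>Both fractions are compared with this quotient, a series in t = w^2.\<close>
  define R where "R = hahn_series q (x * q) (x * q) / hahn_series q x x"
  have "hahn_exton_Phi (inverse q) (\<lambda>s. qpow (- s)) \<nu> = hahn_series q x x oo fps_X ^ 2"
    using q0 x0 by (rule hahn_exton_Phi_eq) (simp only: qpow_inv qpow_add qpow1 x_def)
  moreover have "hahn_exton_Phi (inverse q) (\<lambda>s. qpow (- s)) (\<nu> + 1)
      = hahn_series q (x * q) (x * q) oo fps_X ^ 2"
    using q0 by (rule hahn_exton_Phi_eq) (simp_all only: qpow_inv qpow_add qpow1 x_def x0 q0
        mult_eq_0_iff qpow_nz simp_thms)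
  moreover have "1 / (1 - qpow (- (\<nu> + 1))) = qpow (\<nu> + 1) / (qpow (\<nu> + 1) - 1)"
    using qpow_nz[of "\<nu> + 1"] nu_generic[of 1] unfolding qpow_inv by (simp add: field_simps)
  ultimately have ratio: "hahn_exton_ratio (inverse q) (\<lambda>s. qpow (- s)) \<nu>
      = fps_const (qpow (\<nu> + 1) / (qpow (\<nu> + 1) - 1)) * fps_X * (R oo fps_X ^ 2)"
    by (simp only: hahn_exton_ratio_def R_def) (simp add: fps_divide_compose)

  have "cont_frac b a lam = R"
  proof -
    define G where "G k = hahn_series q (x * q ^ k) (x * q ^ k)" for k
    have "cont_frac b a lam = G 1 / G 0"
    proof (rule cont_frac_eq_ratio)
      show "fps_nth (G k) 0 \<noteq> 0" for k by (simp add: G_def)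
      fix k
      have "b k = x * q ^ k * q / (1 - x * q ^ k * q)"
        by (simp add: b qpow_add qpow_nat qpow1 x_def)
      moreover have "a (Suc k) = x * q ^ k * (x * q ^ k) * q ^ 3
          / ((1 - x * q ^ k * q) * (1 - x * q ^ k * q ^ 2))"
      proof -
        have "qpow (2 * \<nu> + 2 * of_nat (Suc k) + 1) = x ^ 2 * q ^ (2 * Suc k) * q"
          using qpow_nat[of "2 * Suc k"] by (simp only: qpow_add double qpow1 of_nat_mult of_nat_numeral)
        also have "\<dots> = x * q ^ k * (x * q ^ k) * q ^ 3"
          by (simp add: numeral_eq_Suc power_add mult_ac)
        finally have "qpow (2 * \<nu> + 2 * of_nat (Suc k) + 1) = x * q ^ k * (x * q ^ k) * q ^ 3" .
        moreover have "qpow (\<nu> + of_nat (Suc k)) = x * q ^ k * q"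
          by (simp only: qpow_add qpow_nat x_def power_Suc mult_ac)
        moreover from this have "qpow (\<nu> + of_nat (Suc k) + 1) = x * q ^ k * q ^ 2"
          by (simp only: qpow_add[of _ 1] qpow1 power2_eq_square mult.assoc)
        ultimately show ?thesis
          using a[of "Suc k"] by simp
      qed
      moreover have "G (Suc k) = hahn_series q (x * q ^ k * q) (x * q ^ k * q)"
        "G (Suc (Suc k)) = hahn_series q (x * q ^ k * q ^ 2) (x * q ^ k * q ^ 2)"
        by (simp_all add: G_def power2_eq_square mult_ac)
      ultimately show "G k = (1 - fps_const (b k) * fps_X) * G (Suc k)
          - (fps_const (a (Suc k)) * fps_X + fps_const (lam (Suc k)) * fps_X ^ 2) * G (Suc (Suc k))"
        using hahn_series_three_term[of q "x * q ^ k" "x * q ^ k", OF q_generic xkq]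
        by (simp add: G_def lam)
    qed
    then show ?thesis by (simp add: G_def R_def)
  qed
  then have first: "Abs_fps (\<lambda>n. mu b a lam n) = R"
    by (simp add: mu_def fps_eq_iff)

  have "cont_frac b' a' lam' = R oo fps_X ^ 2"
  proof -
    \<comment> \<open>\<open>Suc k div 2\<close> is i for k = 2i and i + 1 for k = 2i + 1: the scale
      advances only on entering an odd index.\<close>
    define S where "S k = hahn_series q (x * q ^ (Suc k div 2)) (x * q ^ k)" for k
    \<comment> \<open>The two contiguous relations alternate: the dilated one for even k, the
      undilated one for odd k.\<close>
    have S: "S k = S (Suc k) - fps_const (lam' (Suc k)) * fps_X * S (Suc (Suc k))" for k
    proof (cases "even k")
      case True
      then obtain i where k: "k = 2 * i" by (rule evenE)
      have y: "qpow (\<nu> + 2 * of_nat i) = x * q ^ k"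
        using qpow_nat[of "2 * i"] by (simp add: k qpow_add x_def)
      have "qpow (\<nu> + 2 * of_nat i + 1) = x * q ^ k * q"
        "qpow (\<nu> + 2 * of_nat i + 2) = x * q ^ k * q ^ 2"
        using qpow_nat[of 2] by (simp_all only: qpow_add[of "\<nu> + _"] y qpow1 of_nat_numeral)
      moreover have "qpow (\<nu> + of_nat i + 1) = x * q ^ i * q"
        by (simp only: qpow_add qpow_nat qpow1 x_def)
      ultimately have "lam' (Suc k) = x * q ^ i * q / ((1 - x * q ^ k * q) * (1 - x * q ^ k * q ^ 2))"
        using lam'_odd[of i] by (simp add: k)
      moreover have "S (Suc k) = hahn_series q (x * q ^ i * q) (x * q ^ k * q)"
        "S (Suc (Suc k)) = hahn_series q (x * q ^ i * q) (x * q ^ k * q ^ 2)"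
        "S k = hahn_series q (x * q ^ i) (x * q ^ k)"
        by (simp_all add: S_def k power2_eq_square mult_ac)
      ultimately show ?thesis
        using hahn_series_contiguous_dilated[of q "x * q ^ k" "x * q ^ i", OF q_generic xkq] by simp
    next
      case False
      then obtain i where k: "k = 2 * i + 1" by (rule oddE)
      \<comment> \<open>Here \<open>Suc k\<close> is 2(i + 1), so \<open>lam'_even\<close> is read
        at \<open>Suc i\<close>.\<close>
      have y: "qpow (\<nu> + 2 * of_nat (Suc i)) = x * q ^ k * q"
        using qpow_nat[of "2 * Suc i"]
        by (simp only: qpow_add of_nat_mult of_nat_numeral) (simp add: k x_def mult_ac)
      then have "qpow (\<nu> + 2 * of_nat (Suc i) + 1) = x * q ^ k * q ^ 2"
        by (simp only: qpow_add[of _ 1] y qpow1 power2_eq_square mult.assoc)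
      moreover have "qpow (2 * \<nu> + 3 * of_nat (Suc i) + 1) = x * q ^ Suc i * (x * q ^ k) * q ^ 2"
      proof -
        have "qpow (2 * \<nu> + 3 * of_nat (Suc i) + 1) = x ^ 2 * q ^ (3 * Suc i) * q"
          using qpow_nat[of "3 * Suc i"] by (simp only: qpow_add double qpow1 of_nat_mult of_nat_numeral)
        also have "\<dots> = x ^ 2 * q ^ (3 * Suc i + 1)"
          by (simp only: power_add power_one_right mult.assoc)
        also have "3 * Suc i + 1 = Suc i + k + 2" by (simp add: k)
        also have "x ^ 2 * q ^ (Suc i + k + 2) = x * q ^ Suc i * (x * q ^ k) * q ^ 2"
          by (simp only: power_add power2_eq_square mult_ac)
        finally show ?thesis .
      qed
      ultimately have "lam' (Suc k) = x * q ^ Suc i * (x * q ^ k) * q ^ 2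
          / ((1 - x * q ^ k * q) * (1 - x * q ^ k * q ^ 2))"
        using lam'_even[of "Suc i"] y by (simp add: k)
      moreover have "S (Suc k) = hahn_series q (x * q ^ Suc i) (x * q ^ k * q)"
        "S (Suc (Suc k)) = hahn_series q (x * q ^ Suc i * q) (x * q ^ k * q ^ 2)"
        "S k = hahn_series q (x * q ^ Suc i) (x * q ^ k)"
        by (simp_all add: S_def k power2_eq_square mult_ac)
      ultimately show ?thesis
        using hahn_series_contiguous[of q "x * q ^ k" "x * q ^ Suc i", OF q_generic xkq] by simp
    qed
    \<comment> \<open>Substituting t^2 for t turns the linear term of \<open>S\<close> into the
      quadratic term carried by \<open>lam'\<close>.\<close>
    have "cont_frac b' a' lam' = (S 1 oo fps_X ^ 2) / (S 0 oo fps_X ^ 2)"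
    proof (rule cont_frac_eq_ratio)
      show "fps_nth (S k oo fps_X ^ 2) 0 \<noteq> 0" for k by (simp add: S_def)
      show "S k oo fps_X ^ 2 = (1 - fps_const (b' k) * fps_X) * (S (Suc k) oo fps_X ^ 2)
          - (fps_const (a' (Suc k)) * fps_X + fps_const (lam' (Suc k)) * fps_X ^ 2)
            * (S (Suc (Suc k)) oo fps_X ^ 2)" for k
        by (subst S) (simp add: b' a' fps_compose_sub_distrib fps_compose_mult_distrib)
    qed
    then show ?thesis by (simp add: S_def R_def fps_divide_compose)
  qed
  then have second: "Abs_fps (\<lambda>n. mu b' a' lam' (2 * n)) = R"
    by (simp add: mu_def fps_eq_iff fps_compose_X_power2_nth_even)

  show ?thesis unfolding ratio first second by simp
qed

end
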